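(* Let $F$ be a simple graph on the vertex set $[r]=\{1,\dots,r\}$, and let $G$ be a blow-up of $F$ with parts $V_1,\dots,V_r$ and $n=|V(G)|$. Then $G$ admits an $\varepsilon$-factorization for some $\varepsilon$ with \[ \varepsilon\le \frac{1}{n^2}\sum_{\substack{b\in[r]\\ |V_b|\text{ odd}}}\ \sum_{a\in N_F(b)}|V_a| \le \frac{r}{n}. \] Moreover, if every non-isolated part $V_b$ (that is, every part $V_b$ for which $b$ is not an isolated vertex of $F$) has even size, then $G$ admits a $0$-factorization.
   Context: All graphs are finite, simple and undirected; $N_H(u)$ denotes the set of neighbours of $u$ in $H$. Let $0\le\varepsilon\le 1$ and let $G$ be a simple graph on $n$ vertices. $G$ admits an $\varepsilon$-factorization if there exist simple graphs $H$ and $K$ on the vertex set $V(G)$ and a set of ordered pairs $\mathcal E\subseteq V(G)\times V(G)$ with $|\mathcal E|\le \varepsilon n^2$ such that, for every $(u,v)\in (V(G)\times V(G))\setminus\mathcal E$ (including pairs with $u=v$), $|N_H(u)\cap N_K(v)|=1$ if $uv\in E(G)$ and $|N_H(u)\cap N_K(v)|=0$ otherwise. Equivalently, for a common ordering of the vertices, $A(H)A(K)$ and $A(G)$ disagree in at most $\varepsilon n^2$ entries. Blow-up: for a simple graph $F$ on $[r]$, a graph $G$ with vertex partition $V(G)=V_1\sqcup\cdots\sqcup V_r$ is a blow-up of $F$ (with parts $V_1,\dots,V_r$) if (1) $G[V_a]$ is edgeless for each $a\in[r]$; and (2) for $a\ne b$, the bipartite graph between $V_a$ and $V_b$ is complete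 if $ab\in E(F)$ and empty if $ab\notin E(F)$. *)

theory Defs
  imports Complex_Main "HOL-Library.Disjoint_Sets" "Graph_Theory.Pair_Digraph"
begin

text \<open>
  A finite simple undirected graph is a \<open>pair_graph\<close>, i.e. a finite vertex set with a finite
  symmetric loop-free arc relation: the undirected edge \<open>uv\<close> is represented by the two
  arcs \<open>(u, v)\<close> and \<open>(v, u)\<close>.
\<close>

definition nbrs :: "'a pair_pre_digraph \<Rightarrow> 'a \<Rightarrow> 'a set" where
  "nbrs G u = {v \<in> pverts G. (u, v) \<in> parcs G}"

definition admits_factorization :: "real \<Rightarrow> 'a pair_pre_digraph \<Rightarrow> bool" where
  "admits_factorization \<epsilon> G \<longleftrightarrow> 0 \<le> \<epsilon> \<and> \<epsilon> \<le> 1 \<and>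
    (\<exists>H K X. pair_graph H \<and> pair_graph K \<and> pverts H = pverts G \<and> pverts K = pverts G \<and>
      X \<subseteq> pverts G \<times> pverts G \<and> real (card X) \<le> \<epsilon> * (real (card (pverts G)))\<^sup>2 \<and>
      (\<forall>(u, v) \<in> (pverts G \<times> pverts G) - X.
        card (nbrs H u \<inter> nbrs K v) = (if (u, v) \<in> parcs G then 1 else 0)))"

text \<open>The parts \<open>V a\<close> are allowed to be empty.\<close>

definition blow_up :: "'b pair_pre_digraph \<Rightarrow> ('b \<Rightarrow> 'a set) \<Rightarrow> 'a pair_pre_digraph \<Rightarrow> bool" where
  "blow_up F V G \<longleftrightarrow>
    pverts G = (\<Union>a\<in>pverts F. V a) \<and> disjoint_family_on V (pverts F) \<and>
    (\<forall>a\<in>pverts F. \<forall>u\<in>V a. \<forall>v\<in>V a. (u, v) \<notin> parcs G) \<and>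
    (\<forall>a\<in>pverts F. \<forall>b\<in>pverts F. a \<noteq> b \<longrightarrow>
      (if (a, b) \<in> parcs F then \<forall>u\<in>V a. \<forall>v\<in>V b. (u, v) \<in> parcs G
       else \<forall>u\<in>V a. \<forall>v\<in>V b. (u, v) \<notin> parcs G))"

end

theory Submission
  imports Defs
begin

text \<open>
  Vertices in the same part of a blow-up have the same neighbours. Hence, if \<open>p\<close> is an
  involution of the vertex set that maps every part to itself, then \<open>u\<close> is adjacent to \<open>p v\<close>
  if and only if it is adjacent to \<open>v\<close>. Take \<open>H = G\<close> and let \<open>K\<close> be the matching
  that joins every non-fixed \<open>v\<close> to \<open>p v\<close>. The only possible common
  element of \<open>N\<^sub>H(u)\<close> and \<open>N\<^sub>K(v)\<close> is then \<open>p v\<close>, and it is one exactly when \<open>uv\<close> is an edge. The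
  exceptions are the pairs \<open>(u, v)\<close> for which \<open>uv\<close> is an edge of \<open>G\<close> and \<open>v\<close> is fixed by \<open>p\<close>,
  because such a \<open>v\<close> is isolated in \<open>K\<close> (lemma \<open>factorization_from_twin_involution\<close>).

  A set can be paired up completely if its size is even, and with one element left over if
  its size is odd (lemmas \<open>ex_involution_card_fixpoints_mod_2\<close> and
  \<open>ex_part_preserving_involution\<close>). So each odd part \<open>V\<^sub>b\<close> contributes one
  exceptional vertex, which lies on \<open>\<Sum>\<^bsub>a \<in> N\<^sub>F(b)\<^esub> |V\<^sub>a|\<close> edges, and the even parts
  contribute nothing. If all non-isolated parts are even, this count is zero.
\<close>

text \<open>Remove two elements at a time and let the involution swap them.\<close>

lemma ex_involution_card_fixpoints_mod_2:
  assumes "finite S"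
  shows "\<exists>p. (\<forall>x\<in>S. p x \<in> S \<and> p (p x) = x) \<and> card {x\<in>S. p x = x} = card S mod 2"
  using assms
proof (induction "card S" arbitrary: S rule: less_induct)
  case less
  show ?case
  proof (cases "card S \<le> 1")
    case True
    have "card S = card S mod 2"
      using True by simp
    then show ?thesis
      by (intro exI[of _ "\<lambda>x. x"]) simp
  next
    case False
    then obtain T where "T \<subseteq> S" "card T = 2"
      using obtain_subset_with_card_n[of 2 S] by auto
    then obtain x y where xy: "x \<in> S" "y \<in> S" "x \<noteq> y"
      by (auto simp: card_2_iff)
    define S' where "S' = S - {x, y}"
    have S: "S = insert x (insert y S')" "x \<notin> S'" "y \<notin> S'" "finite S'"
      using xy less.prems by (auto simp: S'_def)
    have card: "card S = Suc (Suc (card S'))"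
      using S xy by simp
    then obtain q where q: "\<forall>z\<in>S'. q z \<in> S' \<and> q (q z) = z"
        "card {z\<in>S'. q z = z} = card S' mod 2"
      using less.hyps[of S'] S(4) by auto
    define p where "p = q(x := y, y := x)"
    have p_eq: "p z = q z" if "z \<in> S'" for z
      using that S by (auto simp: p_def)
    have "\<forall>z\<in>S. p z \<in> S \<and> p (p z) = z"
    proof
      fix z assume "z \<in> S"
      then consider "z = x" | "z = y" | "z \<in> S'"
        using S(1) by auto
      then show "p z \<in> S \<and> p (p z) = z"
        using q(1) p_eq S(1) xy by cases (auto simp: p_def)
    qed
    moreover have "{z\<in>S. p z = z} = {z\<in>S'. q z = z}"
      using S(1-3) xy p_eq by (auto simp: p_def split: if_splits)
    ultimately show ?thesis
      using q(2) card by (intro exI[of _ p]) simp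
  qed
qed

lemma ex_part_preserving_involution:
  assumes "disjoint_family_on V A" and "\<And>b. b \<in> A \<Longrightarrow> finite (V b)"
  shows "\<exists>p. \<forall>b\<in>A. (\<forall>x\<in>V b. p x \<in> V b \<and> p (p x) = x) \<and>
    card {x\<in>V b. p x = x} = card (V b) mod 2"
proof -
  obtain q where q: "\<And>b. b \<in> A \<Longrightarrow> (\<forall>x\<in>V b. q b x \<in> V b \<and> q b (q b x) = x) \<and>
      card {x\<in>V b. q b x = x} = card (V b) mod 2"
    using ex_involution_card_fixpoints_mod_2[OF assms(2)] by metis
  define p where "p x = q (SOME b. b \<in> A \<and> x \<in> V b) x" for x
  have p_eq: "p x = q b x" if "b \<in> A" "x \<in> V b" for b x
  proof -
    have "(SOME b. b \<in> A \<and> x \<in> V b) = b"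
      using that assms(1) by (intro some_equality) (auto simp: disjoint_family_on_def)
    then show ?thesis
      by (simp add: p_def)
  qed
  show ?thesis
  proof (intro exI[of _ p] ballI)
    fix b assume b: "b \<in> A"
    have "{x\<in>V b. p x = x} = {x\<in>V b. q b x = x}"
      using p_eq[OF b] by auto
    then show "(\<forall>x\<in>V b. p x \<in> V b \<and> p (p x) = x) \<and> card {x\<in>V b. p x = x} = card (V b) mod 2"
      using q[OF b] p_eq[OF b] by simp
  qed
qed

text \<open>
  The factors are \<open>G\<close> itself and the matching given by \<open>p\<close>. Multiplying \<open>A(G)\<close> by the
  permutation matrix of \<open>p\<close> would not change it, since \<open>p\<close> permutes vertices with equal
  neighbourhoods; the matching differs from that permutation only in the loops at fixed
  points, which a simple graph cannot have.
\<close>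

lemma factorization_from_twin_involution:
  assumes G: "pair_graph G"
    and p: "\<And>x. x \<in> pverts G \<Longrightarrow> p x \<in> pverts G \<and> p (p x) = x"
    and twin: "\<And>u v. u \<in> pverts G \<Longrightarrow> v \<in> pverts G \<Longrightarrow>
      (u, p v) \<in> parcs G \<longleftrightarrow> (u, v) \<in> parcs G"
  shows "admits_factorization
    (real (card {(u, v) \<in> parcs G. p v = v}) / (real (card (pverts G)))\<^sup>2) G"
proof -
  interpret G: pair_graph G by (rule G)
  define K where "K = \<lparr>pverts = pverts G, parcs = {(v, p v) | v. v \<in> pverts G \<and> p v \<noteq> v}\<rparr>"
  define X where "X = {(u, v) \<in> parcs G. p v = v}"
  have K: "pair_graph K"
  proof
    show "symmetric K"
      using p unfolding symmetric_def sym_def by (auto simp: K_def dest: sym)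
    have "parcs K \<subseteq> pverts G \<times> pverts G"
      using p by (auto simp: K_def)
    then show "finite (parcs K)"
      by (rule finite_subset) simp
  next
    fix e assume "e \<in> parcs K"
    then show "fst e \<in> pverts K" "snd e \<in> pverts K" "fst e \<noteq> snd e"
      using p by (auto simp: K_def dest: sym)
  next
    show "finite (pverts K)"
      by (simp add: K_def)
  qed
  have X_sub: "X \<subseteq> pverts G \<times> pverts G"
    using G.arc_fst_in_verts G.arc_snd_in_verts by (force simp: X_def)
  then have X_card: "card X \<le> (card (pverts G))\<^sup>2"
    using card_mono[OF _ X_sub] by (simp add: card_cartesian_product power2_eq_square)
  have correct: "card (nbrs G u \<inter> nbrs K v) = (if (u, v) \<in> parcs G then 1 else 0)"
    if "u \<in> pverts G" "v \<in> pverts G" "(u, v) \<notin> X" for u v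
  proof -
    have "nbrs K v = (if p v = v then {} else {p v})"
      using that p by (auto simp: nbrs_def K_def)
    moreover have "p v \<in> nbrs G u \<longleftrightarrow> (u, v) \<in> parcs G"
      using that p twin by (auto simp: nbrs_def)
    ultimately show ?thesis
      using that by (auto simp: X_def)
  qed
  have "real (card X) \<le> (real (card (pverts G)))\<^sup>2"
    using X_card by (metis of_nat_le_iff of_nat_power)
  then have "real (card X) / (real (card (pverts G)))\<^sup>2 \<le> 1"
      "real (card X) \<le> real (card X) / (real (card (pverts G)))\<^sup>2 * (real (card (pverts G)))\<^sup>2"
    by (auto simp: divide_le_eq_1)
  then show ?thesis
    unfolding admits_factorization_def X_def[symmetric]
    using G K X_sub correct
    by (intro conjI exI[of _ G] exI[of _ K] exI[of _ X]) (auto simp: K_def)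
qed

text \<open>
  As \<open>F\<close> has no loops, the condition that parts are edgeless is the case \<open>a = b\<close> of one
  uniform rule.
\<close>

lemma blow_up_adjacent_iff:
  assumes "blow_up F V G" and "pair_graph F"
    and "a \<in> pverts F" "b \<in> pverts F" "u \<in> V a" "v \<in> V b"
  shows "(u, v) \<in> parcs G \<longleftrightarrow> (a, b) \<in> parcs F"
proof -
  interpret F: pair_graph F by (rule assms(2))
  show ?thesis
  proof (cases "a = b")
    case True
    then show ?thesis
      using assms F.no_loops[of "(a, b)"] by (auto simp: blow_up_def)
  next
    case False
    then show ?thesis
      using assms unfolding blow_up_def by metis
  qed
qed

theorem theorem4:
  fixes F :: "nat pair_pre_digraph" and G :: "'a pair_pre_digraph"
    and V :: "nat \<Rightarrow> 'a set" and r n :: nat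
  assumes "pair_graph F" and "pverts F = {1..r}"
    and "pair_graph G" and "blow_up F V G"
    and "n = card (pverts G)"
  shows "(\<exists>\<epsilon>. admits_factorization \<epsilon> G \<and>
            \<epsilon> \<le> 1 / (real n)\<^sup>2 * (\<Sum>b | b \<in> {1..r} \<and> odd (card (V b)). \<Sum>a\<in>nbrs F b. real (card (V a))))
       \<and> 1 / (real n)\<^sup>2 * (\<Sum>b | b \<in> {1..r} \<and> odd (card (V b)). \<Sum>a\<in>nbrs F b. real (card (V a)))
            \<le> real r / real n
       \<and> ((\<forall>b\<in>{1..r}. nbrs F b \<noteq> {} \<longrightarrow> even (card (V b))) \<longrightarrow> admits_factorization 0 G)"
proof -
  interpret F: pair_graph F by (rule assms(1))
  interpret G: pair_graph G by (rule assms(3))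
  define B where "B = {b. b \<in> {1..r} \<and> odd (card (V b))}"
  define S where "S = (\<Sum>b\<in>B. \<Sum>a\<in>nbrs F b. card (V a))"
  have S_real: "(\<Sum>b\<in>B. \<Sum>a\<in>nbrs F b. real (card (V a))) = real S"
    by (simp add: S_def)
  have verts: "pverts G = (\<Union>a\<in>{1..r}. V a)" and disj: "disjoint_family_on V {1..r}"
    using assms(2,4) by (auto simp: blow_up_def)
  have fin: "finite (V a)" if "a \<in> {1..r}" for a
    using G.finite_verts that by (auto simp: verts intro: finite_subset)
  have nbrs: "nbrs F b \<subseteq> {1..r}" for b
    using assms(2) by (auto simp: nbrs_def)
  then have fin_nbrs: "finite (nbrs F b)" for b
    by (rule finite_subset) simp
  have adj: "(u, v) \<in> parcs G \<longleftrightarrow> (a, b) \<in> parcs F"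
    if "a \<in> {1..r}" "b \<in> {1..r}" "u \<in> V a" "v \<in> V b" for a b u v
    using blow_up_adjacent_iff[OF assms(4,1)] that assms(2) by blast

  obtain p where p: "\<And>b x. b \<in> {1..r} \<Longrightarrow> x \<in> V b \<Longrightarrow> p x \<in> V b \<and> p (p x) = x"
      and fixed: "\<And>b. b \<in> {1..r} \<Longrightarrow> card {x\<in>V b. p x = x} = card (V b) mod 2"
    using ex_part_preserving_involution[OF disj fin] by meson
  define X where "X = {(u, v) \<in> parcs G. p v = v}"
  have admits: "admits_factorization (real (card X) / (real n)\<^sup>2) G"
    unfolding X_def assms(5)
  proof (rule factorization_from_twin_involution[OF assms(3)])
    show "p x \<in> pverts G \<and> p (p x) = x" if "x \<in> pverts G" for x
      using that p unfolding verts by blast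
    show "(u, p v) \<in> parcs G \<longleftrightarrow> (u, v) \<in> parcs G" if uv: "u \<in> pverts G" "v \<in> pverts G" for u v
    proof -
      obtain a b where "a \<in> {1..r}" "b \<in> {1..r}" "u \<in> V a" "v \<in> V b"
        using uv unfolding verts by blast
      then show ?thesis
        using adj p by metis
    qed
  qed

  have card_X: "card X \<le> S"
  proof -
    let ?Y = "\<lambda>b a. V a \<times> {x\<in>V b. p x = x}"
    have "X \<subseteq> (\<Union>b\<in>B. \<Union>a\<in>nbrs F b. ?Y b a)"
    proof (rule subrelI)
      fix u v assume "(u, v) \<in> X"
      then have uv: "(u, v) \<in> parcs G" "p v = v"
        by (auto simp: X_def)
      then obtain a b where ab: "a \<in> {1..r}" "b \<in> {1..r}" "u \<in> V a" "v \<in> V b"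
        using G.wellformed[of "(u, v)"] by (auto simp: verts)
      then have "a \<in> nbrs F b"
        using adj uv assms(2) F.arcs_symmetric by (auto simp: nbrs_def)
      moreover have "{x\<in>V b. p x = x} \<noteq> {}"
        using ab uv by auto
      then have "card {x\<in>V b. p x = x} \<noteq> 0"
        using fin[OF ab(2)] by simp
      then have "odd (card (V b))"
        using fixed[OF ab(2)] by (metis even_iff_mod_2_eq_zero)
      ultimately show "(u, v) \<in> (\<Union>b\<in>B. \<Union>a\<in>nbrs F b. ?Y b a)"
        using ab uv by (auto simp: B_def)
    qed
    moreover have "finite (?Y b a)" if "b \<in> B" "a \<in> nbrs F b" for a b
    proof -
      have "a \<in> {1..r}" "b \<in> {1..r}"
        using that nbrs unfolding B_def by blast+
      then show ?thesis
        using fin[of a] fin[of b] by simp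
    qed
    then have "finite (\<Union>b\<in>B. \<Union>a\<in>nbrs F b. ?Y b a)"
      by (intro finite_UN_I fin_nbrs) (simp_all add: B_def)
    ultimately have "card X \<le> card (\<Union>b\<in>B. \<Union>a\<in>nbrs F b. ?Y b a)"
      by (intro card_mono)
    also have "\<dots> \<le> (\<Sum>b\<in>B. card (\<Union>a\<in>nbrs F b. ?Y b a))"
      by (rule card_UN_le) (simp add: B_def)
    also have "\<dots> \<le> (\<Sum>b\<in>B. \<Sum>a\<in>nbrs F b. card (?Y b a))"
      by (intro sum_mono card_UN_le fin_nbrs)
    also have "\<dots> = S"
      unfolding S_def using fixed
      by (intro sum.cong refl) (simp add: B_def card_cartesian_product odd_iff_mod_2_eq_one)
    finally show ?thesis .
  qed

  have n: "n = (\<Sum>a\<in>{1..r}. card (V a))"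
    unfolding assms(5) verts using disj fin
    by (intro card_UN_disjoint) (auto simp: disjoint_family_on_def)
  \<comment> \<open>The neighbourhood of each \<open>b\<close> covers at most all \<open>n\<close> vertices.\<close>
  have "S \<le> (\<Sum>b\<in>B. n)"
    unfolding S_def n by (intro sum_mono sum_mono2 nbrs) auto
  also have "\<dots> \<le> r * n"
    using card_mono[of "{1..r}" B] by (simp add: B_def subset_iff)
  finally have "real S \<le> real r * real n"
    by (metis of_nat_le_iff of_nat_mult)
  \<comment> \<open>For \<open>n = 0\<close> both sides are quotients by zero and hence zero.\<close>
  then have second: "1 / (real n)\<^sup>2 * real S \<le> real r / real n"
    by (cases "n = 0") (simp_all add: field_simps power2_eq_square)

  have first: "real (card X) / (real n)\<^sup>2 \<le> 1 / (real n)\<^sup>2 * real S"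
    using card_X by (simp add: divide_right_mono)

  have third: "admits_factorization 0 G"
    if "\<forall>b\<in>{1..r}. nbrs F b \<noteq> {} \<longrightarrow> even (card (V b))"
  proof -
    have "nbrs F b = {}" if "b \<in> B" for b
      using \<open>\<forall>b\<in>{1..r}. nbrs F b \<noteq> {} \<longrightarrow> even (card (V b))\<close> that unfolding B_def by blast
    then have "S = 0"
      by (simp add: S_def)
    then show ?thesis
      using card_X admits by simp
  qed
  show ?thesis
    unfolding B_def[symmetric] S_real using admits first second third by blast
qed

end
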